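(* Let $F=(f_1,\dots,f_s)\in\mathbb{F}_{q^m}\langle X^q\rangle^s$, with $f_i$ of $q$-degree $d_i$, be such that $f_i$ is coprime with $f_1\vee_l\cdots\vee_l f_{i-1}$ for all $i\in\{2,\dots,s\}$, and let $n=d_1+\cdots+d_s$. Let $A\in\mathbb{F}_{q^m}\langle X^q\rangle$ be of $q$-degree $\alpha$ and let $k<n-\alpha$. Then the $q$CRT code $\mathcal{C}_{F,k,A}$ associated to $F$, $k$ and $A$ is an $\mathbb{F}_{q^m}$-linear rank-metric code of dimension $k$ (over $\mathbb{F}_{q^m}$) and length $n$.
   Context: Let $q$ be a prime power and $m\ge1$. $\mathbb{F}_{q^m}\langle X^q\rangle$ is the set of linearized polynomials $\sum_{i=0}^d p_iX^{q^i}$, $p_i\in\mathbb{F}_{q^m}$, a non-commutative ring under addition and composition $\circ$, determined by $(aX^{q^i})\circ(bX^{q^j})=ab^{q^i}X^{q^{i+j}}$; its unit element is $X$. The $q$-degree $\deg_q(P)$ of a nonzero $P$ is the largest $i$ such that the coefficient of $X^{q^i}$ is nonzero. $\mathbb{F}_{q^m}\langle X^q\rangle_k$ is the set of linearized polynomials of $q$-degree strictly less than $k$ (including $0$), $k\in\mathbb{N}$. For $B\ne0$, right division of $A$ by $B$ is the unique writing $A=Q\circ B+R$ with $R=0$ or $\deg_qR<\deg_qB$. $\vee_l$ denotes the least left common multiple (a generator of the intersection of the left ideals generated); two elements are coprime if their greatest right common divisor is $X$ (up to a nonzero scalar). Let $\pi_i(g)$ be the remainder of the right division of $g$ by $f_i$,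 and $\Psi_A(g)=(\pi_1(g\circ A),\dots,\pi_s(g\circ A))$. The $q$CRT code is $\mathcal{C}_{F,k,A}=\Psi_A(\mathbb{F}_{q^m}\langle X^q\rangle_k)$. A codeword $(p_1,\dots,p_s)$, with $\deg_q p_i<d_i$, is viewed as the element of $\mathbb{F}_{q^m}^n$ obtained by concatenating the coefficient vectors of the $p_i$ (of lengths $d_i$). A (vectorial) rank-metric code of length $n$ is a subspace of $\mathbb{F}_{q^m}^n$, where the rank weight of $v=(v_1,\dots,v_n)$ is $\dim_{\mathbb{F}_q}\langle v_1,\dots,v_n\rangle_{\mathbb{F}_q}$ and the distance is the weight of the difference. *)

theory Defs
  imports
    "HOL-Analysis.Abstract_Metric_Spaces"
    "HOL-Number_Theory.Prime_Powers"
    "Jordan_Normal_Form.VS_Connect"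
begin

section \<open>Linearized polynomials\<close>

text \<open>
  A linearized polynomial is an ordinary polynomial all of whose exponents are of the form
  \<open>q ^ i\<close>. The (non-commutative) product is the composition
  \<open>pcompose\<close> of polynomials, written \<open>\<circ>\<^sub>p\<close>; its unit is \<open>[:0, 1:]\<close>, i.e. \<open>X\<close>.
\<close>

definition linearized :: "nat \<Rightarrow> 'a::zero poly \<Rightarrow> bool" where
  "linearized q P \<longleftrightarrow> (\<forall>j. coeff P j \<noteq> 0 \<longrightarrow> (\<exists>i. j = q ^ i))"

text \<open>Only meaningful for nonzero linearized polynomials and \<open>q \<ge> 2\<close>.\<close>

definition qdeg :: "nat \<Rightarrow> 'a::zero poly \<Rightarrow> nat" where
  "qdeg q P = Max {i. coeff P (q ^ i) \<noteq> 0}"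

definition linearized_less :: "nat \<Rightarrow> nat \<Rightarrow> 'a::zero poly set" where
  "linearized_less q k = {P. linearized q P \<and> (P = 0 \<or> qdeg q P < k)}"

definition left_ideal :: "nat \<Rightarrow> 'a::comm_semiring_0 poly \<Rightarrow> 'a poly set" where
  "left_ideal q P = {Q \<circ>\<^sub>p P | Q. linearized q Q}"

definition right_divides :: "nat \<Rightarrow> 'a::comm_semiring_0 poly \<Rightarrow> 'a poly \<Rightarrow> bool" where
  "right_divides q D P \<longleftrightarrow> (\<exists>Q. linearized q Q \<and> P = Q \<circ>\<^sub>p D)"

definition is_gcrd ::
  "nat \<Rightarrow> 'a::comm_semiring_0 poly \<Rightarrow> 'a poly \<Rightarrow> 'a poly \<Rightarrow> bool" where
  "is_gcrd q D A B \<longleftrightarrow>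
     linearized q D \<and> right_divides q D A \<and> right_divides q D B \<and>
     (\<forall>E. linearized q E \<and> right_divides q E A \<and> right_divides q E B
          \<longrightarrow> right_divides q E D)"

text \<open>Greatest common right divisors are only determined up to a nonzero scalar.\<close>

definition right_coprime ::
  "nat \<Rightarrow> 'a::comm_semiring_1 poly \<Rightarrow> 'a poly \<Rightarrow> bool" where
  "right_coprime q A B \<longleftrightarrow> (\<exists>c. c \<noteq> 0 \<and> is_gcrd q [:0, c:] A B)"

text \<open>
  The least left common multiple of a nonempty finite set of linearized polynomials.
  It is determined only up to a nonzero scalar, which is irrelevant for coprimality.
\<close>

definition llcm :: "nat \<Rightarrow> 'a::comm_semiring_0 poly set \<Rightarrow> 'a poly" where
  "llcm q S = (SOME L. linearized q L \<and> left_ideal q L = (\<Inter>P\<in>S. left_ideal q P))"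

definition right_rem ::
  "nat \<Rightarrow> 'a::comm_semiring_0 poly \<Rightarrow> 'a poly \<Rightarrow> 'a poly" where
  "right_rem q A B =
     (THE R. linearized q R \<and> (R = 0 \<or> qdeg q R < qdeg q B) \<and>
        (\<exists>Q. linearized q Q \<and> A = Q \<circ>\<^sub>p B + R))"


section \<open>The code\<close>

definition crt_map ::
  "nat \<Rightarrow> 'a::comm_semiring_0 poly list \<Rightarrow> 'a poly \<Rightarrow> 'a poly \<Rightarrow> 'a poly list" where
  "crt_map q F A g = map (right_rem q (g \<circ>\<^sub>p A)) F"

definition qcrt_code ::
  "nat \<Rightarrow> 'a::comm_semiring_0 poly list \<Rightarrow> nat \<Rightarrow> 'a poly \<Rightarrow> 'a poly list set" where
  "qcrt_code q F k A = crt_map q F A ` linearized_less q k"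

text \<open>
  A tuple of linearized polynomials as one vector: the coefficient vectors of the components,
  the \<open>i\<close>-th one of length \<open>qdeg q (F ! i)\<close>, are concatenated.
\<close>

definition codeword_vec ::
  "nat \<Rightarrow> 'a::zero poly list \<Rightarrow> 'a poly list \<Rightarrow> 'a vec" where
  "codeword_vec q F ps =
     vec_of_list (concat (map2 (\<lambda>f p. map (\<lambda>j. coeff p (q ^ j)) [0..<qdeg q f]) F ps))"


section \<open>Rank-metric codes\<close>

text \<open>The subfield with \<open>q\<close> elements of a field with \<open>q ^ m\<close> elements.\<close>

definition Fq_ring :: "nat \<Rightarrow> 'a::field ring" where
  "Fq_ring q = class_ring\<lparr>carrier := {x. x ^ q = x}\<rparr>"

definition self_module :: "('a::field, 'a) module" where
  "self_module =
     \<lparr>carrier = UNIV, mult = (*), one = 1, zero = 0, add = (+), smult = (*)\<rparr>"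

definition rank_weight :: "nat \<Rightarrow> 'a::field vec \<Rightarrow> nat" where
  "rank_weight q v =
     vectorspace.dim (Fq_ring q)
       (self_module\<lparr>carrier := LinearCombinations.module.span (Fq_ring q) self_module (set\<^sub>v v)\<rparr>)"

text \<open>
  \<open>Metric_space\<close> demands symmetry also outside its carrier, where subtraction of vectors of
  different dimensions is not well behaved; hence the default value \<open>0\<close>.
\<close>

definition rank_dist :: "nat \<Rightarrow> nat \<Rightarrow> 'a::field vec \<Rightarrow> 'a vec \<Rightarrow> real" where
  "rank_dist q n u v =
     (if u \<in> carrier_vec n \<and> v \<in> carrier_vec n then real (rank_weight q (u - v)) else 0)"

definition rank_metric_code :: "nat \<Rightarrow> nat \<Rightarrow> 'a::field vec set \<Rightarrow> bool" where
  "rank_metric_code q n C \<longleftrightarrow>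
     Metric_space (carrier_vec n :: 'a vec set) (rank_dist q n) \<and>
     VectorSpace.subspace class_ring C (module_vec TYPE('a) n)"

definition code_dim :: "nat \<Rightarrow> 'a::field vec set \<Rightarrow> nat" where
  "code_dim n C = vectorspace.dim class_ring ((module_vec TYPE('a) n)\<lparr>carrier := C\<rparr>)"

end

theory Submission
  imports Defs
begin

text \<open>
  Left ideals of linearized polynomials are principal, by right division. If \<open>f\<close> and \<open>L\<close> are
  right coprime, a Bezout identity makes the reduction modulo \<open>f\<close> and \<open>L\<close> surjective, so
  counting shows that a nonzero common left multiple has \<open>q\<close>-degree at least the sum of the
  two \<open>q\<close>-degrees. By induction a nonzero common left multiple of all \<open>f\<^sub>i\<close> has \<open>q\<close>-degree at
  least \<open>n\<close>. If \<open>g\<close> is encoded by \<open>0\<close>, then \<open>g \<circ> A\<close> is such a multiple of \<open>q\<close>-degree less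
  than \<open>n\<close>, hence \<open>g = 0\<close>; the encoding is injective and linear.
\<close>

section \<open>The ring of linearized polynomials\<close>

text \<open>The assumptions have the form that additivity of Frobenius asks for: \<open>q\<close> is
  a power of the characteristic. \<open>linearized_polys_of_card\<close> derives them for a field
  with \<open>q ^ m\<close> elements.\<close>

locale linearized_polys =
  fixes q e :: nat and ty :: "'a::{field,finite} itself"
  assumes prime_CHAR: "prime CHAR('a)"
    and q_def: "q = CHAR('a) ^ e"
    and e_pos: "e > 0"
begin

section \<open>Frobenius additivity and composition of linearized polynomials\<close>

lemma q_gt_1: "q > 1"
  unfolding q_def using one_less_power[OF prime_gt_1_nat[OF prime_CHAR] e_pos] .

lemma q_pos: "q > 0"
  using q_gt_1 by simp

lemma q_power_eq_iff [simp]: "q ^ i = q ^ j \<longleftrightarrow> i = j"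
  using power_inject_exp[OF q_gt_1] .

lemma q_power_less_iff [simp]: "q ^ i < q ^ j \<longleftrightarrow> i < j"
  using power_strict_increasing_iff[OF q_gt_1] .

lemma less_q_power: "i < q ^ i"
  using power_gt_expt[of q i] q_gt_1 by simp

lemma frobenius_add: "(x + y :: 'a) ^ q = x ^ q + y ^ q"
  by (rule freshmans_dream'[OF prime_CHAR q_def])

text \<open>The polynomial ring has the characteristic of its coefficient field, so raising to a
  power of \<open>q\<close> is additive there too. All ring laws special to linearized polynomials
  rest on this.\<close>

lemma poly_frobenius_add: "(P + Q :: 'a poly) ^ (q ^ i) = P ^ (q ^ i) + Q ^ (q ^ i)"
proof (rule freshmans_dream')
  show "prime CHAR('a poly)"
    using prime_CHAR by simp
  show "q ^ i = CHAR('a poly) ^ (e * i)"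
    by (simp add: q_def power_mult)
qed

lemma linearized_0 [simp]: "linearized q (0 :: 'a poly)"
  by (simp add: linearized_def)

lemma linearized_monom [simp]: "linearized q (monom (c :: 'a) (q ^ i))"
  by (auto simp: linearized_def)

lemma linearized_scalar [simp]: "linearized q [:0, c :: 'a:]"
  using linearized_monom[of c 0] by (simp add: monom_Suc monom_0)

lemma linearized_add [simp]:
  "linearized q P \<Longrightarrow> linearized q Q \<Longrightarrow> linearized q (P + Q :: 'a poly)"
  unfolding linearized_def by (metis coeff_add add_0)

lemma linearized_uminus [simp]: "linearized q P \<Longrightarrow> linearized q (- P :: 'a poly)"
  by (simp add: linearized_def)

lemma linearized_diff [simp]:
  "linearized q P \<Longrightarrow> linearized q Q \<Longrightarrow> linearized q (P - Q :: 'a poly)"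
  using linearized_add[of P "- Q"] by simp

lemma linearized_smult [simp]:
  "linearized q P \<Longrightarrow> linearized q (Polynomial.smult (c :: 'a) P)"
  by (auto simp: linearized_def)

lemma linearized_sum:
  "(\<And>i. i \<in> I \<Longrightarrow> linearized q (f i :: 'a poly)) \<Longrightarrow> linearized q (sum f I)"
  by (induct I rule: infinite_finite_induct) auto

lemma linearized_eqI:
  assumes "linearized q P" "linearized q Q" "\<And>i. coeff P (q ^ i) = coeff Q (q ^ i :: nat)"
  shows "P = (Q :: 'a poly)"
proof (rule poly_eqI)
  fix j
  show "coeff P j = coeff Q j"
    using assms unfolding linearized_def by metis
qed

lemma coeff_sum_monom:
  "coeff (\<Sum>i<k. monom (c i :: 'a) (q ^ i)) (q ^ j) = (if j < k then c j else 0)"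
  by (simp add: coeff_sum if_distrib cong: if_cong)

lemma linearized_expansion:
  assumes P: "linearized q (P :: 'a poly)" and k: "\<And>i. i \<ge> k \<Longrightarrow> coeff P (q ^ i) = 0"
  shows "P = (\<Sum>i<k. monom (coeff P (q ^ i)) (q ^ i))"
  using P k
  by (intro linearized_eqI linearized_sum) (auto simp: coeff_sum_monom not_less[symmetric])

lemma linearized_induct [consumes 1, case_names 0 add]:
  assumes P: "linearized q (P :: 'a poly)" and 0: "R 0"
    and add: "\<And>c i Q. linearized q Q \<Longrightarrow> R Q \<Longrightarrow> R (monom c (q ^ i) + Q)"
  shows "R P"
proof -
  have R: "R (\<Sum>i<k. monom (c i) (q ^ i))" for k and c :: "nat \<Rightarrow> 'a"
  proof (induction k)
    case (Suc k)
    then show ?case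
      using add[OF linearized_sum[of "{..<k}" "\<lambda>i. monom (c i) (q ^ i)"], of "c k" k]
      by (simp add: add.commute)
  qed (simp add: 0)
  \<comment> \<open>Since \<open>i < q ^ i\<close>, every exponent \<open>q ^ i\<close> with
    \<open>i\<close> above the ordinary degree exceeds that degree, so \<open>Suc (degree P)\<close>
    terms suffice.\<close>
  have "P = (\<Sum>i<Suc (degree P). monom (coeff P (q ^ i)) (q ^ i))"
  proof (rule linearized_expansion[OF P])
    fix i
    assume "i \<ge> Suc (degree P)"
    then have "degree P < q ^ i"
      using less_q_power[of i] by simp
    then show "coeff P (q ^ i) = 0"
      by (rule coeff_eq_0)
  qed
  then show ?thesis
    using R by metis
qed

lemma monom_pcompose: "monom (c :: 'a) n \<circ>\<^sub>p P = Polynomial.smult c (P ^ n)"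
  by (induct n) (simp_all add: monom_0 monom_Suc pcompose_pCons)

lemma linearized_power: "linearized q (P :: 'a poly) \<Longrightarrow> linearized q (P ^ (q ^ i))"
proof (induct rule: linearized_induct)
  case 0
  then show ?case
    using q_pos by (simp add: power_0_left)
next
  case (add c j Q)
  then show ?case
    by (simp add: poly_frobenius_add monom_power flip: power_add)
qed

lemma linearized_pcompose [simp]:
  "linearized q P \<Longrightarrow> linearized q Q \<Longrightarrow> linearized q (P \<circ>\<^sub>p Q :: 'a poly)"
  by (induct rule: linearized_induct)
    (simp_all add: pcompose_add monom_pcompose linearized_power)

text \<open>Additivity in the left argument holds for all polynomials; in the right argument it
  comes from Frobenius, because composing with a monomial from the left is a scaled
  \<open>q ^ i\<close>-th power.\<close>

lemma pcompose_add_right: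
  "linearized q P \<Longrightarrow> P \<circ>\<^sub>p (Q + R) = P \<circ>\<^sub>p Q + P \<circ>\<^sub>p (R :: 'a poly)"
  by (induct rule: linearized_induct)
    (simp_all add: pcompose_add monom_pcompose poly_frobenius_add smult_add_right)

lemma pcompose_0_right: "linearized q P \<Longrightarrow> P \<circ>\<^sub>p 0 = (0 :: 'a poly)"
  using pcompose_add_right[of P 0 0] by (metis add_0 add_cancel_right_right)

lemma scalar_pcompose: "[:0, c :: 'a:] \<circ>\<^sub>p P = Polynomial.smult c P"
  by (simp add: pcompose_pCons)

subsection \<open>The q-degree\<close>

text \<open>The bridge from \<open>qdeg\<close> to the ordinary degree. Facts about degrees of
  compositions carry over: multiplicativity of \<open>degree\<close> becomes additivity of
  \<open>qdeg\<close>.\<close>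

lemma degree_linearized:
  assumes P: "linearized q P" "P \<noteq> (0 :: 'a poly)"
  shows "degree P = q ^ qdeg q P"
proof -
  obtain i where i: "degree P = q ^ i"
    using P by (metis linearized_def leading_coeff_neq_0)
  have le: "j \<le> i" if "coeff P (q ^ j) \<noteq> 0" for j
    using le_degree[OF that] i by (simp add: not_less[symmetric])
  have "qdeg q P = i"
    unfolding qdeg_def
  proof (rule Max_eqI)
    show "finite {i. coeff P (q ^ i) \<noteq> 0}"
      by (rule finite_subset[of _ "{..i}"]) (use le in auto)
    show "i \<in> {i. coeff P (q ^ i) \<noteq> 0}"
      using P i by (metis leading_coeff_neq_0 mem_Collect_eq)
  qed (use le in auto)
  then show ?thesis
    using i by simp
qed

lemma degree_linearized_pos: "linearized q P \<Longrightarrow> P \<noteq> (0 :: 'a poly) \<Longrightarrow> degree P > 0"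
  using q_pos by (simp add: degree_linearized)

text \<open>A composition of nonzero polynomials can vanish only if the inner one is constant, and a
  nonzero linearized polynomial has positive degree. So there are no zero divisors.\<close>

lemma pcompose_eq_0_iff_linearized:
  "linearized q P \<Longrightarrow> linearized q Q \<Longrightarrow> P \<circ>\<^sub>p Q = 0 \<longleftrightarrow> P = 0 \<or> Q = (0 :: 'a poly)"
  using pcompose_0_right[of P] pcompose_eq_0[of P Q] degree_linearized_pos[of Q] by auto

lemma qdeg_pcompose:
  assumes "linearized q P" "P \<noteq> 0" "linearized q Q" "Q \<noteq> (0 :: 'a poly)"
  shows "qdeg q (P \<circ>\<^sub>p Q) = qdeg q P + qdeg q Q"
proof -
  have "q ^ qdeg q (P \<circ>\<^sub>p Q) = q ^ (qdeg q P + qdeg q Q)"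
    using assms degree_pcompose[of P Q]
    by (simp add: degree_linearized pcompose_eq_0_iff_linearized power_add)
  then show ?thesis
    by (simp only: q_power_eq_iff)
qed

text \<open>Coefficients replace the case distinction on zero, which makes closure under the linear
  operations immediate.\<close>

lemma mem_linearized_less_iff:
  "P \<in> linearized_less q k \<longleftrightarrow> linearized q P \<and> (\<forall>i\<ge>k. coeff P (q ^ i) = (0 :: 'a))"
proof (cases "linearized q P \<and> P \<noteq> 0")
  case True
  then have deg: "degree P = q ^ qdeg q P" and lc: "coeff P (q ^ qdeg q P) \<noteq> 0"
    by (auto simp: degree_linearized leading_coeff_neq_0 simp flip: degree_linearized)
  have "coeff P (q ^ i) = 0" if "qdeg q P < i" for i
    by (rule coeff_eq_0) (use deg that in simp)
  with True lc show ?thesis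
    by (auto simp: linearized_less_def) (meson not_le order.strict_trans2)+
qed (auto simp: linearized_less_def)

lemma linearized_less_linearized: "P \<in> linearized_less q k \<Longrightarrow> linearized q (P :: 'a poly)"
  by (simp add: linearized_less_def)

lemma linearized_less_diff:
  "P \<in> linearized_less q k \<Longrightarrow> Q \<in> linearized_less q k \<Longrightarrow> P - Q \<in> linearized_less q k"
  for P Q :: "'a poly"
  by (simp add: mem_linearized_less_iff)

lemma linearized_less_add:
  "P \<in> linearized_less q k \<Longrightarrow> Q \<in> linearized_less q k \<Longrightarrow> P + Q \<in> linearized_less q k"
  for P Q :: "'a poly"
  by (simp add: mem_linearized_less_iff)

lemma linearized_less_smult:
  "P \<in> linearized_less q k \<Longrightarrow> Polynomial.smult c P \<in> linearized_less q k"
  for P :: "'a poly"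
  by (simp add: mem_linearized_less_iff)

lemma sum_monom_linearized_less:
  "(\<Sum>i<k. monom (c i) (q ^ i)) \<in> linearized_less q k" for c :: "nat \<Rightarrow> 'a"
  by (auto simp: mem_linearized_less_iff coeff_sum_monom intro: linearized_sum)

text \<open>Prepares the count of polynomials of bounded \<open>q\<close>-degree. The coefficient
  families are extensional functions, so that each polynomial has exactly one.\<close>

lemma bij_betw_coeffs:
  "bij_betw (\<lambda>c. \<Sum>i<k. monom (c i) (q ^ i)) ({..<k} \<rightarrow>\<^sub>E UNIV) (linearized_less q k :: 'a poly set)"
proof (rule bij_betw_byWitness[where f' = "\<lambda>P. \<lambda>i\<in>{..<k}. coeff P (q ^ i)"])
  show "\<forall>P\<in>linearized_less q k :: 'a poly set. (\<Sum>i<k. monom (restrict (\<lambda>i. coeff P (q ^ i)) {..<k} i) (q ^ i)) = P"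
    by (auto simp: mem_linearized_less_iff intro!: linearized_expansion[symmetric])
  show "\<forall>c\<in>{..<k} \<rightarrow>\<^sub>E UNIV.
      (\<lambda>i\<in>{..<k}. coeff (\<Sum>i<k. monom (c i :: 'a) (q ^ i)) (q ^ i)) = c"
  proof (intro ballI ext)
    fix c :: "nat \<Rightarrow> 'a" and i
    assume c: "c \<in> {..<k} \<rightarrow>\<^sub>E UNIV"
    show "(\<lambda>i\<in>{..<k}. coeff (\<Sum>i<k. monom (c i) (q ^ i)) (q ^ i)) i = c i"
      unfolding restrict_def coeff_sum_monom using PiE_arb[OF c, of i] by simp
  qed
  show "(\<lambda>c. \<Sum>i<k. monom (c i) (q ^ i)) ` ({..<k} \<rightarrow>\<^sub>E UNIV) \<subseteq> (linearized_less q k :: 'a poly set)"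
    by (intro image_subsetI sum_monom_linearized_less)
  show "(\<lambda>P. \<lambda>i\<in>{..<k}. coeff P (q ^ i)) ` (linearized_less q k :: 'a poly set) \<subseteq> {..<k} \<rightarrow>\<^sub>E UNIV"
    by (intro image_subsetI) (simp only: restrict_PiE_iff UNIV_I ball_triv simp_thms)
qed

lemma finite_linearized_less: "finite (linearized_less q k :: 'a poly set)"
  using bij_betw_finite[OF bij_betw_coeffs] by (simp add: finite_PiE)

lemma card_linearized_less: "card (linearized_less q k :: 'a poly set) = CARD('a) ^ k"
  using bij_betw_same_card[OF bij_betw_coeffs] by (simp add: card_funcsetE)

subsection \<open>Right division\<close>

lemma right_division_ex:
  assumes A: "linearized q (A :: 'a poly)" and B: "linearized q B" "B \<noteq> 0"
  shows "\<exists>Q R. linearized q Q \<and> R \<in> linearized_less q (qdeg q B) \<and> A = Q \<circ>\<^sub>p B + R"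
  using A
proof (induct "degree A" arbitrary: A rule: less_induct)
  case less
  show ?case
  proof (cases "A \<in> linearized_less q (qdeg q B)")
    case True
    then show ?thesis
      by (intro exI[of _ 0] exI[of _ A]) simp
  next
    case False
    then have A0: "A \<noteq> 0" and le: "qdeg q B \<le> qdeg q A"
      using less.prems by (auto simp: linearized_less_def)
    \<comment> \<open>The leading coefficient of \<open>M \<circ>\<^sub>p B\<close> is that of
      \<open>M\<close> times a \<open>q\<close>-power of that of \<open>B\<close>. Dividing by this
      power makes the leading terms of \<open>M \<circ>\<^sub>p B\<close> and \<open>A\<close>
      agree, so subtraction lowers the degree.\<close>
    define M where "M = monom (lead_coeff A / lead_coeff B ^ (q ^ (qdeg q A - qdeg q B))) (q ^ (qdeg q A - qdeg q B))"
    have M: "linearized q M"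
      by (simp add: M_def)
    have degM: "degree M = q ^ (qdeg q A - qdeg q B)"
      using A0 B by (simp add: M_def degree_monom_eq)
    have deg: "degree (M \<circ>\<^sub>p B) = degree A"
      using less.prems A0 B le degM by (simp add: degree_pcompose degree_linearized flip: power_add)
    have "lead_coeff (M \<circ>\<^sub>p B) = lead_coeff A"
      using B degM by (simp add: lead_coeff_comp degree_linearized_pos) (simp add: M_def)
    then have coeff0: "coeff (A - M \<circ>\<^sub>p B) (degree A) = 0"
      using deg by simp
    have lin: "linearized q (A - M \<circ>\<^sub>p B)"
      using less.prems M B by simp
    show ?thesis
    proof (cases "A - M \<circ>\<^sub>p B = 0")
      case True
      then show ?thesis
        using M by (intro exI[of _ M] exI[of _ 0]) (simp add: linearized_less_def)
    next
      case False
      then have "degree (A - M \<circ>\<^sub>p B) < degree A"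
        using coeff0 deg by (intro degree_less_if_less_eqI degree_diff_le) auto
      from less.hyps[OF this lin] obtain Q R
        where "linearized q Q" "R \<in> linearized_less q (qdeg q B)" "A - M \<circ>\<^sub>p B = Q \<circ>\<^sub>p B + R"
        by blast
      then show ?thesis
        using M by (intro exI[of _ "M + Q"] exI[of _ R]) (auto simp: pcompose_add algebra_simps)
    qed
  qed
qed

text \<open>By additivity of \<open>qdeg\<close>, a nonzero left multiple of \<open>B\<close> has at
  least the \<open>q\<close>-degree of \<open>B\<close>. This gives uniqueness of
  remainders.\<close>

lemma pcompose_mem_linearized_less:
  assumes "linearized q Q" "linearized q B" "B \<noteq> 0" "Q \<circ>\<^sub>p B \<in> linearized_less q (qdeg q B)"
  shows "Q = (0 :: 'a poly)"
  using assms qdeg_pcompose[of Q B]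
  by (cases "Q = 0") (auto simp: linearized_less_def pcompose_eq_0_iff_linearized)

text \<open>Resolves the definite description in \<open>right_rem\<close>: two remainders differ by
  a left multiple of \<open>B\<close> of too small \<open>q\<close>-degree, hence not at
  all.\<close>

lemma right_remI:
  assumes Q: "linearized q Q" and B: "linearized q B" "B \<noteq> (0 :: 'a poly)"
    and R: "R \<in> linearized_less q (qdeg q B)" and A: "A = Q \<circ>\<^sub>p B + R"
  shows "right_rem q A B = R"
  unfolding right_rem_def
proof (rule the_equality)
  show "linearized q R \<and> (R = 0 \<or> qdeg q R < qdeg q B) \<and> (\<exists>Q. linearized q Q \<and> A = Q \<circ>\<^sub>p B + R)"
    using Q R A by (auto simp: linearized_less_def)
next
  fix R' :: "'a poly"
  assume "linearized q R' \<and> (R' = 0 \<or> qdeg q R' < qdeg q B) \<and> (\<exists>Q. linearized q Q \<and> A = Q \<circ>\<^sub>p B + R')"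
  then obtain Q' where R': "R' \<in> linearized_less q (qdeg q B)" and Q': "linearized q Q'"
    and A': "A = Q' \<circ>\<^sub>p B + R'"
    by (auto simp: linearized_less_def)
  have eq: "(Q - Q') \<circ>\<^sub>p B = R' - R"
    using A A' by (simp add: pcompose_diff algebra_simps)
  moreover have "R' - R \<in> linearized_less q (qdeg q B)"
    using R' R by (rule linearized_less_diff)
  ultimately have "Q - Q' = 0"
    using Q Q' B by (intro pcompose_mem_linearized_less[of _ B]) simp_all
  then show "R' = R"
    using eq by simp
qed

lemma right_rem_division:
  assumes "linearized q A" "linearized q B" "B \<noteq> (0 :: 'a poly)"
  obtains Q where "linearized q Q" "right_rem q A B \<in> linearized_less q (qdeg q B)"
    "A = Q \<circ>\<^sub>p B + right_rem q A B"
  using right_division_ex[OF assms] right_remI assms by metis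

lemma right_rem_add:
  assumes "linearized q A" "linearized q A'" "linearized q B" "B \<noteq> (0 :: 'a poly)"
  shows "right_rem q (A + A') B = right_rem q A B + right_rem q A' B"
proof -
  obtain Q Q' where "linearized q Q" "right_rem q A B \<in> linearized_less q (qdeg q B)"
      "A = Q \<circ>\<^sub>p B + right_rem q A B"
    and "linearized q Q'" "right_rem q A' B \<in> linearized_less q (qdeg q B)"
      "A' = Q' \<circ>\<^sub>p B + right_rem q A' B"
    using assms right_rem_division by metis
  moreover from this have "A + A' = (Q + Q') \<circ>\<^sub>p B + (right_rem q A B + right_rem q A' B)"
    by (metis (no_types, opaque_lifting) pcompose_add add.assoc add.commute)
  ultimately show ?thesis
    using assms by (intro right_remI[of "Q + Q'"]) (simp_all add: linearized_less_add)
qed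

lemma right_rem_smult:
  assumes "linearized q A" "linearized q B" "B \<noteq> (0 :: 'a poly)"
  shows "right_rem q (Polynomial.smult c A) B = Polynomial.smult c (right_rem q A B)"
proof -
  obtain Q where "linearized q Q" "right_rem q A B \<in> linearized_less q (qdeg q B)"
      "A = Q \<circ>\<^sub>p B + right_rem q A B"
    using assms right_rem_division by metis
  moreover from this have "Polynomial.smult c A
      = Polynomial.smult c Q \<circ>\<^sub>p B + Polynomial.smult c (right_rem q A B)"
    by (metis pcompose_smult smult_add_right)
  ultimately show ?thesis
    using assms by (intro right_remI[of "Polynomial.smult c Q"]) (simp_all add: linearized_less_smult)
qed

lemma right_rem_eq_0_imp_left_ideal:
  assumes "linearized q A" "linearized q B" "B \<noteq> (0 :: 'a poly)" "right_rem q A B = 0"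
  shows "A \<in> left_ideal q B"
  using right_rem_division[OF assms(1-3)] assms(4) by (auto simp: left_ideal_def)

subsection \<open>Left ideals are principal\<close>

definition is_left_ideal :: "'a poly set \<Rightarrow> bool" where
  "is_left_ideal I \<longleftrightarrow> I \<subseteq> Collect (linearized q) \<and> 0 \<in> I \<and>
     (\<forall>P\<in>I. \<forall>Q\<in>I. P - Q \<in> I) \<and> (\<forall>P\<in>I. \<forall>Q. linearized q Q \<longrightarrow> Q \<circ>\<^sub>p P \<in> I)"

lemma is_left_ideal_left_ideal:
  assumes P: "linearized q P"
  shows "is_left_ideal (left_ideal q P)"
proof -
  have mem: "Q \<circ>\<^sub>p P \<in> left_ideal q P" if "linearized q Q" for Q
    using that by (auto simp: left_ideal_def)
  show ?thesis
    unfolding is_left_ideal_def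
  proof (intro conjI ballI allI impI)
    show "left_ideal q P \<subseteq> Collect (linearized q)"
      using P by (auto simp: left_ideal_def)
    show "0 \<in> left_ideal q P"
      using mem[of 0] by simp
  next
    fix A B
    assume "A \<in> left_ideal q P" "B \<in> left_ideal q P"
    then obtain Q R where "linearized q Q" "linearized q R" "A = Q \<circ>\<^sub>p P" "B = R \<circ>\<^sub>p P"
      by (auto simp: left_ideal_def)
    then show "A - B \<in> left_ideal q P"
      using mem[of "Q - R"] by (simp add: pcompose_diff)
  next
    fix A R :: "'a poly"
    assume "A \<in> left_ideal q P" "linearized q R"
    then obtain Q where "linearized q Q" "A = Q \<circ>\<^sub>p P"
      by (auto simp: left_ideal_def)
    then show "R \<circ>\<^sub>p A \<in> left_ideal q P"
      using mem[of "R \<circ>\<^sub>p Q"] \<open>linearized q R\<close> by (simp add: pcompose_assoc)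
  qed
qed

lemma left_ideal_0: "left_ideal q 0 = {0 :: 'a poly}"
proof -
  have "0 \<circ>\<^sub>p 0 \<in> left_ideal q (0 :: 'a poly)"
    unfolding left_ideal_def using linearized_0 by blast
  moreover have "left_ideal q (0 :: 'a poly) \<subseteq> {0}"
    by (auto simp: left_ideal_def pcompose_0_right)
  ultimately show ?thesis
    by (auto simp: pcompose_0_right)
qed

lemma is_left_ideal_INT:
  assumes "S \<noteq> {}" and f: "\<And>P. P \<in> S \<Longrightarrow> is_left_ideal (f P)"
  shows "is_left_ideal (\<Inter>P\<in>S. f P)"
  unfolding is_left_ideal_def
proof (intro conjI)
  show "(\<Inter>P\<in>S. f P) \<subseteq> Collect (linearized q)"
    using assms by (fastforce simp: is_left_ideal_def)
qed (use f in \<open>simp_all add: is_left_ideal_def\<close>)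

text \<open>A nonzero element of least \<open>q\<close>-degree generates: the remainder of any other
  element lies in the ideal and must vanish by minimality. The zero ideal has no such element and is
  treated first.\<close>

lemma left_ideal_principal:
  assumes I: "is_left_ideal I"
  obtains L where "linearized q L" "L \<in> I" "I = left_ideal q L"
proof (cases "I = {0}")
  case True
  then show ?thesis
    using that[of 0] left_ideal_0 by simp
next
  case False
  then have "\<exists>P. P \<in> I \<and> P \<noteq> 0"
    using I by (auto simp: is_left_ideal_def)
  then obtain L where L: "L \<in> I" "L \<noteq> 0"
    and min: "\<And>P. P \<in> I \<Longrightarrow> P \<noteq> 0 \<Longrightarrow> qdeg q L \<le> qdeg q P"
    using arg_min_natI[of "\<lambda>P. P \<in> I \<and> P \<noteq> 0" _ "qdeg q"]
      arg_min_nat_le[of "\<lambda>P. P \<in> I \<and> P \<noteq> 0" _ "qdeg q"]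
    by blast
  have lin: "linearized q L"
    using I L by (auto simp: is_left_ideal_def)
  have "P \<in> left_ideal q L" if P: "P \<in> I" for P
  proof -
    have "linearized q P"
      using I P by (auto simp: is_left_ideal_def)
    then obtain Q where Q: "linearized q Q" and R: "right_rem q P L \<in> linearized_less q (qdeg q L)"
      and eq: "P = Q \<circ>\<^sub>p L + right_rem q P L"
      using right_rem_division lin L by blast
    have "right_rem q P L = P - Q \<circ>\<^sub>p L"
      using eq by (simp add: algebra_simps)
    also have "\<dots> \<in> I"
      using I L P Q by (simp add: is_left_ideal_def)
    finally have "right_rem q P L \<in> I" .
    then have "right_rem q P L = 0"
      using min[of "right_rem q P L"] R unfolding linearized_less_def by fastforce
    then show ?thesis
      using Q eq by (auto simp: left_ideal_def)
  qed
  moreover have "left_ideal q L \<subseteq> I"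
    using I L by (auto simp: is_left_ideal_def left_ideal_def)
  ultimately show ?thesis
    using that L lin by blast
qed

text \<open>An intersection of left ideals is a left ideal, hence principal; this supplies the
  witness for the choice operator in \<open>llcm\<close>.\<close>

lemma llcm:
  assumes "S \<noteq> {}" "\<And>P. P \<in> S \<Longrightarrow> linearized q (P :: 'a poly)"
  shows linearized_llcm: "linearized q (llcm q S)"
    and left_ideal_llcm: "left_ideal q (llcm q S) = (\<Inter>P\<in>S. left_ideal q P)"
proof -
  have "is_left_ideal (\<Inter>P\<in>S. left_ideal q P)"
    using assms by (intro is_left_ideal_INT is_left_ideal_left_ideal)
  then obtain L where "linearized q L" "L \<in> (\<Inter>P\<in>S. left_ideal q P)"
    "(\<Inter>P\<in>S. left_ideal q P) = left_ideal q L"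
    by (rule left_ideal_principal)
  then have "\<exists>L. linearized q L \<and> left_ideal q L = (\<Inter>P\<in>S. left_ideal q P)"
    by metis
  from someI_ex[OF this, folded llcm_def]
  show "linearized q (llcm q S)" "left_ideal q (llcm q S) = (\<Inter>P\<in>S. left_ideal q P)"
    by simp_all
qed

subsection \<open>Coprime elements\<close>

text \<open>The left ideal generated by \<open>A\<close> and \<open>B\<close> has a generator
  \<open>G\<close>, which right divides both. So \<open>G\<close> right divides their greatest
  common right divisor, a scalar multiple of \<open>X\<close>, which therefore lies in the
  ideal.\<close>

lemma right_coprime_bezout:
  assumes cop: "right_coprime q A B" and A: "linearized q A" and B: "linearized q (B :: 'a poly)"
  obtains U V where "linearized q U" "linearized q V" "[:0, 1:] = U \<circ>\<^sub>p A + V \<circ>\<^sub>p B"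
proof -
  define I where "I = {U \<circ>\<^sub>p A + V \<circ>\<^sub>p B | U V. linearized q U \<and> linearized q V}"
  have memI: "U \<circ>\<^sub>p A + V \<circ>\<^sub>p B \<in> I" if "linearized q U" "linearized q V" for U V
    using that by (auto simp: I_def)
  have "is_left_ideal I"
    unfolding is_left_ideal_def
  proof (intro conjI ballI allI impI)
    show "I \<subseteq> Collect (linearized q)"
      using A B by (auto simp: I_def)
    show "0 \<in> I"
      using memI[of 0 0] by simp
  next
    fix P Q :: "'a poly"
    assume "P \<in> I" "Q \<in> I"
    then obtain U V U' V' where "linearized q U" "linearized q V" "linearized q U'" "linearized q V'"
      and "P = U \<circ>\<^sub>p A + V \<circ>\<^sub>p B" "Q = U' \<circ>\<^sub>p A + V' \<circ>\<^sub>p B"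
      by (auto simp: I_def)
    then show "P - Q \<in> I"
      using memI[of "U - U'" "V - V'"] by (simp add: pcompose_diff algebra_simps)
  next
    fix P Q :: "'a poly"
    assume "P \<in> I" and Q: "linearized q Q"
    then obtain U V where "linearized q U" "linearized q V" "P = U \<circ>\<^sub>p A + V \<circ>\<^sub>p B"
      by (auto simp: I_def)
    then show "Q \<circ>\<^sub>p P \<in> I"
      using memI[of "Q \<circ>\<^sub>p U" "Q \<circ>\<^sub>p V"] Q by (simp add: pcompose_add_right pcompose_assoc)
  qed
  then obtain G where G: "linearized q G" "I = left_ideal q G"
    using left_ideal_principal by blast
  have "A \<in> I" "B \<in> I"
    using memI[of "[:0, 1:]" 0] memI[of 0 "[:0, 1:]"] by (simp_all add: scalar_pcompose)
  then have "right_divides q G A" "right_divides q G B"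
    using G by (auto simp: left_ideal_def right_divides_def)
  then obtain c where c: "c \<noteq> 0" and "right_divides q G [:0, c:]"
    using cop G by (auto simp: right_coprime_def is_gcrd_def)
  then have "[:0, c:] \<in> I"
    using G by (auto simp: left_ideal_def right_divides_def)
  then obtain U V where UV: "linearized q U" "linearized q V" and "[:0, c:] = U \<circ>\<^sub>p A + V \<circ>\<^sub>p B"
    by (auto simp: I_def)
  \<comment> \<open>A scalar can be pulled into the left factor of a composition, so dividing by
    \<open>c\<close> normalizes the identity to \<open>X\<close>.\<close>
  from this(3) have "Polynomial.smult (1 / c) [:0, c:]
      = Polynomial.smult (1 / c) U \<circ>\<^sub>p A + Polynomial.smult (1 / c) V \<circ>\<^sub>p B"
    by (simp add: pcompose_smult smult_add_right)
  with c show ?thesis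
    using UV by (intro that[of "Polynomial.smult (1 / c) U" "Polynomial.smult (1 / c) V"]) simp_all
qed

text \<open>By Bezout, reduction modulo \<open>L\<close> and \<open>f\<close> is onto, already on the remainders modulo
  the common multiple \<open>h\<close>; the bound follows by counting.\<close>

lemma qdeg_common_multiple_ge:
  assumes L: "linearized q L" "L \<noteq> 0" and f: "linearized q f" "f \<noteq> (0 :: 'a poly)"
    and cop: "right_coprime q f L"
    and h: "h \<in> left_ideal q L" "h \<in> left_ideal q f" "h \<noteq> 0"
  shows "qdeg q L + qdeg q f \<le> qdeg q h"
proof -
  obtain U V where U: "linearized q U" and V: "linearized q V"
    and UV: "[:0, 1:] = U \<circ>\<^sub>p f + V \<circ>\<^sub>p L"
    using right_coprime_bezout[OF cop] f L by blast
  obtain M N where M: "linearized q M" "h = M \<circ>\<^sub>p L" and N: "linearized q N" "h = N \<circ>\<^sub>p f"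
    using h by (auto simp: left_ideal_def)
  have lin_h: "linearized q h"
    using M L by simp
  let ?crt = "\<lambda>g. (right_rem q g L, right_rem q g f)"
  have "linearized_less q (qdeg q L) \<times> linearized_less q (qdeg q f) \<subseteq> ?crt ` linearized_less q (qdeg q h)"
  proof clarify
    fix a b :: "'a poly"
    assume a: "a \<in> linearized_less q (qdeg q L)" and b: "b \<in> linearized_less q (qdeg q f)"
    have lin: "linearized q a" "linearized q b"
      using a b by (auto simp: linearized_less_linearized)
    \<comment> \<open>The Chinese remainder preimage. With juxtaposition for composition,
      \<open>aU f = a - aV L\<close> gives remainder \<open>a\<close> modulo \<open>L\<close>, and
      \<open>bV L = b - bU f\<close> gives remainder \<open>b\<close> modulo
      \<open>f\<close>.\<close>
    define g where "g = (a \<circ>\<^sub>p U) \<circ>\<^sub>p f + (b \<circ>\<^sub>p V) \<circ>\<^sub>p L"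
    have g: "linearized q g"
      using lin U V L f by (simp add: g_def)
    have "a = a \<circ>\<^sub>p (U \<circ>\<^sub>p f + V \<circ>\<^sub>p L)" "b = b \<circ>\<^sub>p (U \<circ>\<^sub>p f + V \<circ>\<^sub>p L)"
      using UV by (metis pcompose_idR)+
    then have ab: "a = (a \<circ>\<^sub>p U) \<circ>\<^sub>p f + (a \<circ>\<^sub>p V) \<circ>\<^sub>p L" "b = (b \<circ>\<^sub>p U) \<circ>\<^sub>p f + (b \<circ>\<^sub>p V) \<circ>\<^sub>p L"
      using lin by (simp_all add: pcompose_add_right pcompose_assoc)
    \<comment> \<open>Reducing \<open>g\<close> modulo the common left multiple \<open>h\<close>
      keeps both remainders and brings the preimage into the set being counted.\<close>
    obtain Q r where Q: "linearized q Q" and r: "r \<in> linearized_less q (qdeg q h)"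
      and eq: "g = Q \<circ>\<^sub>p h + r"
      using right_division_ex[OF g lin_h h(3)] by blast
    have rL: "right_rem q r L = a"
    proof (rule right_remI[of "b \<circ>\<^sub>p V - a \<circ>\<^sub>p V - Q \<circ>\<^sub>p M"])
      have "r = g - Q \<circ>\<^sub>p (M \<circ>\<^sub>p L)"
        using eq M by (simp add: algebra_simps)
      also have "g = (b \<circ>\<^sub>p V - a \<circ>\<^sub>p V) \<circ>\<^sub>p L + a"
        using ab(1) by (simp add: g_def pcompose_diff algebra_simps)
      finally show "r = (b \<circ>\<^sub>p V - a \<circ>\<^sub>p V - Q \<circ>\<^sub>p M) \<circ>\<^sub>p L + a"
        by (simp only: pcompose_diff pcompose_assoc) (simp add: algebra_simps)
    qed (use a lin V Q M L in auto)
    have rf: "right_rem q r f = b"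
    proof (rule right_remI[of "a \<circ>\<^sub>p U - b \<circ>\<^sub>p U - Q \<circ>\<^sub>p N"])
      have "r = g - Q \<circ>\<^sub>p (N \<circ>\<^sub>p f)"
        using eq N by (simp add: algebra_simps)
      also have "g = (a \<circ>\<^sub>p U - b \<circ>\<^sub>p U) \<circ>\<^sub>p f + b"
        using ab(2) by (simp add: g_def pcompose_diff algebra_simps)
      finally show "r = (a \<circ>\<^sub>p U - b \<circ>\<^sub>p U - Q \<circ>\<^sub>p N) \<circ>\<^sub>p f + b"
        by (simp only: pcompose_diff pcompose_assoc) (simp add: algebra_simps)
    qed (use b lin U Q N f in auto)
    show "(a, b) \<in> ?crt ` linearized_less q (qdeg q h)"
      by (rule image_eqI[where x = r]) (simp_all add: r rL rf)
  qed
  then have "card (linearized_less q (qdeg q L) \<times> linearized_less q (qdeg q f) :: ('a poly \<times> 'a poly) set)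
      \<le> card (linearized_less q (qdeg q h) :: 'a poly set)"
    by (rule order_trans[OF card_mono[OF finite_imageI[OF finite_linearized_less]]
          card_image_le[OF finite_linearized_less]])
  then have "CARD('a) ^ (qdeg q L + qdeg q f) \<le> CARD('a) ^ qdeg q h"
    by (simp add: card_cartesian_product card_linearized_less power_add)
  moreover have "1 < CARD('a)"
    using card_mono[of UNIV "{0, 1 :: 'a}"] by simp
  ultimately show ?thesis
    by (simp add: power_increasing_iff)
qed

text \<open>Coprimality relates each entry to the prefix before it, so the induction splits off the
  last entry.\<close>

lemma qdeg_common_multiple_list_ge:
  assumes F: "\<And>f. f \<in> set F \<Longrightarrow> linearized q f \<and> f \<noteq> (0 :: 'a poly)"
    and cop: "\<And>i. 1 \<le> i \<Longrightarrow> i < length F \<Longrightarrow> right_coprime q (F ! i) (llcm q (set (take i F)))"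
    and h: "h \<in> (\<Inter>f\<in>set F. left_ideal q f)" "h \<noteq> 0" and ne: "F \<noteq> []"
  shows "(\<Sum>f\<leftarrow>F. qdeg q f) \<le> qdeg q h"
  using F cop h ne
proof (induction F arbitrary: h rule: rev_induct)
  case (snoc f F)
  have f: "linearized q f" "f \<noteq> 0" and hf: "h \<in> left_ideal q f"
    using snoc.prems by auto
  show ?case
  proof (cases "F = []")
    \<comment> \<open>\<open>llcm\<close> is characterized only for nonempty sets; for a single
      \<open>f\<close> the bound is that of a nonzero left multiple.\<close>
    case True
    obtain Q where "linearized q Q" "h = Q \<circ>\<^sub>p f"
      using hf by (auto simp: left_ideal_def)
    then show ?thesis
      using True f \<open>h \<noteq> 0\<close> by (auto simp: qdeg_pcompose pcompose_eq_0_iff_linearized)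
  next
    case False
    define L where "L = llcm q (set F)"
    have lin: "linearized q L" and L: "left_ideal q L = (\<Inter>P\<in>set F. left_ideal q P)"
      using False snoc.prems(1) unfolding L_def by (intro llcm; simp)+
    have hL: "h \<in> left_ideal q L"
      using snoc.prems(3) L by auto
    \<comment> \<open>The nonzero \<open>h\<close> is a left multiple of \<open>L\<close>; this
      rules out \<open>L = 0\<close>.\<close>
    have L0: "L \<noteq> 0"
      using hL \<open>h \<noteq> 0\<close> by (auto simp: left_ideal_def pcompose_0_right)
    have "L \<in> left_ideal q L"
      by (auto simp: left_ideal_def scalar_pcompose intro: exI[of _ "[:0, 1:]"])
    have "right_coprime q (F ! i) (llcm q (set (take i F)))" if "1 \<le> i" "i < length F" for i
      using snoc.prems(2)[of i] that by (simp add: nth_append)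
    \<comment> \<open>The induction hypothesis is used at \<open>L\<close>, itself a nonzero common
      left multiple of the prefix, and not at \<open>h\<close>.\<close>
    then have "(\<Sum>f\<leftarrow>F. qdeg q f) \<le> qdeg q L"
      using snoc.IH[of L] snoc.prems(1) L0 False L \<open>L \<in> left_ideal q L\<close> by auto
    moreover have "right_coprime q f L"
      using snoc.prems(2)[of "length F"] False by (simp add: L_def Suc_le_eq)
    then have "qdeg q L + qdeg q f \<le> qdeg q h"
      using qdeg_common_multiple_ge lin L0 f hL hf \<open>h \<noteq> 0\<close> by blast
    ultimately show ?thesis
      by simp
  qed
qed simp

end

section \<open>The rank metric\<close>

context vectorspace
begin

text \<open>A basis is chosen inside the subspace \<open>span S\<close> and transported to
  \<open>V\<close>: span and linear independence of a subset of a submodule are the same in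
  both.\<close>

lemma span_basis:
  assumes S: "finite S" "S \<subseteq> carrier V"
  obtains B where "finite B" "B \<subseteq> carrier V" "lin_indpt B" "span B = span S"
    "card B = vectorspace.dim K (vs (span S))"
proof -
  have sub: "submodule K (span S) V"
    by (rule span_is_submodule[OF S(2)])
  interpret W: vectorspace K "vs (span S)"
    using S by (intro subspace_is_vs span_is_subspace)
  have SS: "S \<subseteq> span S"
    by (rule in_own_span[OF S(2)])
  then have "W.fin_dim"
    using S span_li_not_depend(1)[OF SS sub] unfolding W.fin_dim_def by auto
  then obtain B where B: "finite B" "W.basis B"
    using W.finite_basis_exists by blast
  then have BS: "B \<subseteq> span S"
    unfolding W.basis_def by simp
  have "span B = span S" "lin_indpt B"
    using B(2) span_li_not_depend[OF BS sub] unfolding W.basis_def by simp_all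
  then show ?thesis
    using that B BS span_is_subset2[of S] S W.dim_basis by auto
qed

text \<open>Steinitz exchange, applied to a basis of \<open>span S\<close> and the generating set
  \<open>B\<close>.\<close>

lemma dim_span_le_card:
  assumes S: "finite S" "S \<subseteq> span B" and B: "finite B" "B \<subseteq> carrier V"
  shows "vectorspace.dim K (vs (span S)) \<le> card B"
proof -
  have "S \<subseteq> carrier V"
    using S span_is_subset2[OF B(2)] by blast
  then obtain A where A: "finite A" "A \<subseteq> carrier V" "lin_indpt A" "span A = span S"
    and card: "card A = vectorspace.dim K (vs (span S))"
    using span_basis S by metis
  have "A \<subseteq> span S"
    using in_own_span A by metis
  also have "\<dots> \<subseteq> span B"
    using S B by (intro span_is_subset span_is_submodule)
  finally have "A \<subseteq> span B" .
  from replacement[OF A(1) B(1,2) A(3) this] card show ?thesis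
    by auto
qed

text \<open>Bases of the two spans together generate the span of the union. This becomes the
  triangle inequality of the rank distance.\<close>

lemma dim_span_Un_le:
  assumes "finite S" "S \<subseteq> span (T \<union> U)"
    and T: "finite T" "T \<subseteq> carrier V" and U: "finite U" "U \<subseteq> carrier V"
  shows "vectorspace.dim K (vs (span S)) \<le> vectorspace.dim K (vs (span T)) + vectorspace.dim K (vs (span U))"
proof -
  obtain A where A: "finite A" "A \<subseteq> carrier V" "span A = span T"
    and cA: "card A = vectorspace.dim K (vs (span T))"
    using span_basis[OF T] by metis
  obtain B where B: "finite B" "B \<subseteq> carrier V" "span B = span U"
    and cB: "card B = vectorspace.dim K (vs (span U))"
    using span_basis[OF U] by metis
  have "span (T \<union> U) = span (A \<union> B)"
    using span_Un T U A B by metis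
  then have "vectorspace.dim K (vs (span S)) \<le> card (A \<union> B)"
    using assms A B by (intro dim_span_le_card) auto
  also have "\<dots> \<le> card A + card B"
    by (rule card_Un_le)
  finally show ?thesis
    using cA cB by simp
qed

lemma dim_span_mono:
  assumes "finite S" "S \<subseteq> span T" "finite T" "T \<subseteq> carrier V"
  shows "vectorspace.dim K (vs (span S)) \<le> vectorspace.dim K (vs (span T))"
  using span_basis[OF assms(3,4)] dim_span_le_card[OF assms(1)] assms(2) by metis

lemma dim_span_eq_0_iff:
  assumes S: "finite S" "S \<subseteq> carrier V"
  shows "vectorspace.dim K (vs (span S)) = 0 \<longleftrightarrow> S \<subseteq> {\<zero>\<^bsub>V\<^esub>}"
proof
  assume "vectorspace.dim K (vs (span S)) = 0"
  then have "span {} = span S"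
    using span_basis[OF S] by (metis card_eq_0_iff)
  then show "S \<subseteq> {\<zero>\<^bsub>V\<^esub>}"
    using in_own_span[OF S(2)] by (simp add: span_empty)
next
  assume "S \<subseteq> {\<zero>\<^bsub>V\<^esub>}"
  then show "vectorspace.dim K (vs (span S)) = 0"
    using dim_span_le_card[of S "{}"] S by (simp add: span_empty)
qed

end

section \<open>The fixed field of Frobenius and the metric axioms\<close>

context linearized_polys
begin

lemma field_Fq_ring: "field (Fq_ring q :: 'a ring)"
proof -
  \<comment> \<open>Expanding \<open>0 = (x + - x) ^ q\<close> by Frobenius additivity gives
    \<open>(- x) ^ q = - x\<close>, with no case distinction on the parity of
    \<open>q\<close>.\<close>
  have neg: "\<exists>y. y ^ q = y \<and> x + y = 0" if "x ^ q = x" for x :: 'a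
    using frobenius_add[of x "- x"] that q_pos
    by (intro exI[of _ "- x"]) (simp add: power_0_left add_eq_0_iff)
  interpret cring "Fq_ring q :: 'a ring"
    by (rule cringI[OF abelian_groupI comm_monoidI])
      (use q_pos neg in \<open>auto simp: Fq_ring_def frobenius_add power_mult_distrib algebra_simps\<close>)
  have "\<exists>y. y ^ q = y \<and> y * x = 1 \<and> x * y = 1" if "x ^ q = x" "x \<noteq> 0" for x :: 'a
    using that by (intro exI[of _ "inverse x"]) (simp add: power_inverse)
  then show ?thesis
    by (intro cring_fieldI) (auto simp: Units_def Fq_ring_def)
qed

lemma vectorspace_self_module:
  "vectorspace (Fq_ring q) (self_module :: ('a, 'a) module)"
  by (rule vs_criteria[OF field_Fq_ring])
    (auto simp: self_module_def Fq_ring_def algebra_simps intro: exI[of _ "- _"])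

interpretation Fq: vectorspace "Fq_ring q" "self_module :: ('a, 'a) module"
  by (rule vectorspace_self_module)

lemma self_module_simps:
  "carrier (self_module :: ('a, 'a) module) = UNIV"
  "add (self_module :: ('a, 'a) module) = (+)"
  "zero (self_module :: ('a, 'a) module) = 0"
  by (simp_all add: self_module_def)

lemma a_inv_self_module: "a_inv (self_module :: ('a, 'a) module) x = - x"
  by (rule Fq.minus_equality) (simp_all add: self_module_simps)

lemma finite_vec_set: "finite (set\<^sub>v (v :: 'a vec))"
  by (simp add: vec_set_def)

text \<open>Up to sign, \<open>x - y\<close> and \<open>y - x\<close> have the same entries, and
  each entry of \<open>x - z\<close> is a sum of entries of \<open>x - y\<close> and
  \<open>y - z\<close>. Rank zero forces all entries to vanish.\<close>

lemma Metric_space_rank_dist: "Metric_space (carrier_vec n) (rank_dist q n :: 'a vec \<Rightarrow> 'a vec \<Rightarrow> real)"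
proof
  show "0 \<le> rank_dist q n x y" for x y :: "'a vec"
    by (simp add: rank_dist_def)
next
  \<comment> \<open>One inequality suffices, as \<open>x\<close> and \<open>y\<close> may be
    exchanged; off the carrier both distances are \<open>0\<close> by definition.\<close>
  have "rank_weight q (x - y) \<le> rank_weight q (y - x)"
    if xy: "x \<in> carrier_vec n" "y \<in> carrier_vec n" for x y :: "'a vec"
    unfolding rank_weight_def
  proof (rule Fq.dim_span_mono)
    show "set\<^sub>v (x - y) \<subseteq> Fq.span (set\<^sub>v (y - x))"
    proof
      fix a
      assume "a \<in> set\<^sub>v (x - y)"
      then obtain i where "i < n" "a = x $ i - y $ i"
        using xy by (auto elim!: vec_setE)
      then have "- a \<in> set\<^sub>v (y - x)"
        using xy by (intro vec_setI[of _ i]) auto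
      then have "- a \<in> Fq.span (set\<^sub>v (y - x))"
        using Fq.in_own_span[of "set\<^sub>v (y - x)"] by (auto simp: self_module_simps)
      then show "a \<in> Fq.span (set\<^sub>v (y - x))"
        using Fq.span_neg[of "set\<^sub>v (y - x)" "- a"] by (simp add: self_module_simps a_inv_self_module)
    qed
  qed (simp_all add: finite_vec_set self_module_simps)
  then show "rank_dist q n x y = rank_dist q n y x" for x y :: "'a vec"
    unfolding rank_dist_def by (auto intro: antisym)
next
  fix x y :: "'a vec"
  assume xy: "x \<in> carrier_vec n" "y \<in> carrier_vec n"
  have "rank_weight q (x - y) = 0 \<longleftrightarrow> set\<^sub>v (x - y) \<subseteq> {0}"
    unfolding rank_weight_def
    by (subst Fq.dim_span_eq_0_iff) (simp_all add: finite_vec_set self_module_simps)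
  also have "\<dots> \<longleftrightarrow> (\<forall>i<n. x $ i - y $ i = 0)"
    using xy by (auto simp: vec_set_def)
  also have "\<dots> \<longleftrightarrow> x = y"
    using xy by (auto intro: eq_vecI)
  finally show "rank_dist q n x y = 0 \<longleftrightarrow> x = y"
    using xy by (simp add: rank_dist_def)
next
  fix x y z :: "'a vec"
  assume xyz: "x \<in> carrier_vec n" "y \<in> carrier_vec n" "z \<in> carrier_vec n"
  have "rank_weight q (x - z) \<le> rank_weight q (x - y) + rank_weight q (y - z)"
    unfolding rank_weight_def
  proof (rule Fq.dim_span_Un_le)
    let ?S = "set\<^sub>v (x - y) \<union> set\<^sub>v (y - z)"
    show "set\<^sub>v (x - z) \<subseteq> Fq.span ?S"
    proof
      fix a
      assume "a \<in> set\<^sub>v (x - z)"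
      then obtain i where i: "i < n" "a = (x $ i - y $ i) + (y $ i - z $ i)"
        using xyz by (auto elim!: vec_setE)
      have "x $ i - y $ i \<in> ?S" "y $ i - z $ i \<in> ?S"
        using xyz i by (auto intro!: vec_setI[of _ i])
      then have "x $ i - y $ i \<in> Fq.span ?S" "y $ i - z $ i \<in> Fq.span ?S"
        using Fq.in_own_span[of ?S] by (auto simp: self_module_simps)
      then show "a \<in> Fq.span ?S"
        using Fq.span_add1[of ?S "x $ i - y $ i" "y $ i - z $ i"] i by (simp add: self_module_simps)
    qed
  qed (simp_all add: finite_vec_set self_module_simps)
  then show "rank_dist q n x z \<le> rank_dist q n x y + rank_dist q n y z"
    using xyz by (simp add: rank_dist_def)
qed

end

section \<open>The code\<close>

context linearized_polys
begin

text \<open>Labels each codeword coordinate with its divisor and coefficient index, so that a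
  concatenation of blocks can be treated as a single indexed vector.\<close>

definition code_positions :: "'a poly list \<Rightarrow> ('a poly \<times> nat) list" where
  "code_positions F = concat (map (\<lambda>f. map (Pair f) [0..<qdeg q f]) F)"

lemma set_code_positions: "set (code_positions F) = {(f, j). f \<in> set F \<and> j < qdeg q f}"
  by (auto simp: code_positions_def)

lemma length_code_positions: "length (code_positions F) = (\<Sum>f\<leftarrow>F. qdeg q f)"
  by (simp add: code_positions_def length_concat o_def)

lemma codeword_vec_crt_map:
  "codeword_vec q F (crt_map q F A g) = vec (\<Sum>f\<leftarrow>F. qdeg q f)
     (\<lambda>i. (\<lambda>(f, j). coeff (right_rem q (g \<circ>\<^sub>p A) f) (q ^ j)) (code_positions F ! i))"
proof -
  let ?c = "\<lambda>(f, j). coeff (right_rem q (g \<circ>\<^sub>p A) f) (q ^ j)"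
  have "concat (map2 (\<lambda>f p. map (\<lambda>j. coeff p (q ^ j)) [0..<qdeg q f]) F (map (right_rem q (g \<circ>\<^sub>p A)) F))
      = map ?c (code_positions F)"
    by (induct F) (simp_all add: code_positions_def o_def)
  then have "codeword_vec q F (crt_map q F A g) = vec_of_list (map ?c (code_positions F))"
    by (simp add: codeword_vec_def crt_map_def)
  also have "\<dots> = vec (\<Sum>f\<leftarrow>F. qdeg q f) (\<lambda>i. ?c (code_positions F ! i))"
    by (intro eq_vecI) (simp_all add: length_code_positions vec_of_list_index)
  finally show ?thesis .
qed

text \<open>The codeword records the coefficients of the remainder below \<open>qdeg q f\<close>;
  those from there on vanish by the degree bound.\<close>

lemma right_rem_eq_0_of_codeword_vec:
  assumes f: "f \<in> set F" "linearized q f" "f \<noteq> (0 :: 'a poly)" and g: "linearized q (g \<circ>\<^sub>p A)"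
    and 0: "codeword_vec q F (crt_map q F A g) = 0\<^sub>v n" and n: "n = (\<Sum>f\<leftarrow>F. qdeg q f)"
  shows "right_rem q (g \<circ>\<^sub>p A) f = 0"
proof -
  have R: "right_rem q (g \<circ>\<^sub>p A) f \<in> linearized_less q (qdeg q f)"
    using right_rem_division[OF g f(2,3)] by metis
  have small: "coeff (right_rem q (g \<circ>\<^sub>p A) f) (q ^ j) = 0" if j: "j < qdeg q f" for j
  proof -
    have "(f, j) \<in> set (code_positions F)"
      using f(1) j by (simp add: set_code_positions)
    then obtain i where i: "i < n" "code_positions F ! i = (f, j)"
      by (auto simp: in_set_conv_nth length_code_positions n)
    have "codeword_vec q F (crt_map q F A g) $ i = 0"
      using 0 i by simp
    then show ?thesis
      using i by (simp add: codeword_vec_crt_map n)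
  qed
  show ?thesis
  proof (rule linearized_eqI)
    show "coeff (right_rem q (g \<circ>\<^sub>p A) f) (q ^ j) = coeff 0 (q ^ j)" for j
      using small[of j] R by (cases "j < qdeg q f") (auto simp: mem_linearized_less_iff)
  qed (use R linearized_less_linearized in auto)
qed

lemma crt_map_injective:
  assumes F: "\<And>f. f \<in> set F \<Longrightarrow> linearized q f \<and> f \<noteq> (0 :: 'a poly)"
    and cop: "\<And>i. 1 \<le> i \<Longrightarrow> i < length F \<Longrightarrow> right_coprime q (F ! i) (llcm q (set (take i F)))"
    and A: "linearized q A" "A \<noteq> 0" and n: "n = (\<Sum>f\<leftarrow>F. qdeg q f)" "k + qdeg q A < n"
    and g: "g \<in> linearized_less q k" and 0: "codeword_vec q F (crt_map q F A g) = 0\<^sub>v n"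
  shows "g = 0"
proof (rule ccontr)
  assume "g \<noteq> 0"
  then have g': "linearized q g" "qdeg q g < k"
    using g by (auto simp: linearized_less_def)
  have lin: "linearized q (g \<circ>\<^sub>p A)"
    using g' A by simp
  \<comment> \<open>An empty list would give \<open>n = 0\<close>, against
    \<open>k + qdeg q A < n\<close>.\<close>
  have ne: "F \<noteq> []"
    using n by auto
  have "g \<circ>\<^sub>p A \<in> (\<Inter>f\<in>set F. left_ideal q f)"
    using right_rem_eq_0_imp_left_ideal[OF lin] right_rem_eq_0_of_codeword_vec[OF _ _ _ lin 0 n(1)] F
    by blast
  moreover have "g \<circ>\<^sub>p A \<noteq> 0"
    using \<open>g \<noteq> 0\<close> g' A by (simp add: pcompose_eq_0_iff_linearized)
  ultimately have "n \<le> qdeg q (g \<circ>\<^sub>p A)"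
    unfolding n(1) using qdeg_common_multiple_list_ge F cop ne by blast
  also have "\<dots> = qdeg q g + qdeg q A"
    using \<open>g \<noteq> 0\<close> g' A by (simp add: qdeg_pcompose)
  finally show False
    using g' n by simp
qed

text \<open>Messages become vectors of length \<open>k\<close>, so that encoding is a linear map
  between coordinate spaces and rank-nullity applies.\<close>

definition poly_of_coeffs :: "nat \<Rightarrow> 'a vec \<Rightarrow> 'a poly" where
  "poly_of_coeffs k c = (\<Sum>i<k. monom (c $ i) (q ^ i))"

lemma poly_of_coeffs_less: "poly_of_coeffs k c \<in> linearized_less q k"
  unfolding poly_of_coeffs_def by (rule sum_monom_linearized_less)

lemma poly_of_coeffs_image: "poly_of_coeffs k ` carrier_vec k = linearized_less q k"
proof
  show "linearized_less q k \<subseteq> poly_of_coeffs k ` carrier_vec k"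
  proof
    fix P :: "'a poly"
    assume "P \<in> linearized_less q k"
    then have "P = poly_of_coeffs k (vec k (\<lambda>i. coeff P (q ^ i)))"
      using linearized_expansion[of P k] by (simp add: poly_of_coeffs_def mem_linearized_less_iff)
    then show "P \<in> poly_of_coeffs k ` carrier_vec k"
      by (rule image_eqI) simp
  qed
qed (use poly_of_coeffs_less in auto)

lemma poly_of_coeffs_add:
  "c \<in> carrier_vec k \<Longrightarrow> c' \<in> carrier_vec k \<Longrightarrow>
    poly_of_coeffs k (c + c') = poly_of_coeffs k c + poly_of_coeffs k c'"
  by (simp add: poly_of_coeffs_def add_monom flip: sum.distrib)

lemma poly_of_coeffs_smult:
  "c \<in> carrier_vec k \<Longrightarrow> poly_of_coeffs k (a \<cdot>\<^sub>v c) = Polynomial.smult a (poly_of_coeffs k c)"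
  by (intro linearized_eqI)
    (simp_all add: poly_of_coeffs_def coeff_sum_monom linearized_sum)

lemma poly_of_coeffs_eq_0:
  assumes c: "c \<in> carrier_vec k" and 0: "poly_of_coeffs k c = 0"
  shows "c = 0\<^sub>v k"
proof (rule eq_vecI)
  fix i
  assume "i < dim_vec (0\<^sub>v k :: 'a vec)"
  then show "c $ i = 0\<^sub>v k $ i"
    using arg_cong[OF 0, of "\<lambda>P. coeff P (q ^ i)"] by (simp add: poly_of_coeffs_def coeff_sum_monom)
qed (use c in simp)

text \<open>The message enters as the left factor of the composition, where composition is linear
  over the coefficient field. Right remainders are linear as well, and linearity is then checked
  coordinatewise.\<close>

lemma linear_map_encode:
  assumes F: "\<And>f. f \<in> set F \<Longrightarrow> linearized q f \<and> f \<noteq> (0 :: 'a poly)" and A: "linearized q A"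
    and n: "n = (\<Sum>f\<leftarrow>F. qdeg q f)"
  shows "linear_map class_ring (module_vec TYPE('a) k) (module_vec TYPE('a) n)
    (\<lambda>c. codeword_vec q F (crt_map q F A (poly_of_coeffs k c)))"
proof -
  let ?enc = "\<lambda>c. codeword_vec q F (crt_map q F A (poly_of_coeffs k c))"
  have lin: "linearized q (poly_of_coeffs k c \<circ>\<^sub>p A)" for c
    using linearized_less_linearized[OF poly_of_coeffs_less] A by simp
  \<comment> \<open>Every coordinate belongs to a nonzero linearized divisor, as the linearity of
    \<open>right_rem\<close> requires.\<close>
  have pos: "\<exists>f j. code_positions F ! i = (f, j) \<and> linearized q f \<and> f \<noteq> 0" if "i < n" for i
    using nth_mem[of i "code_positions F"] that F
    by (auto simp: set_code_positions length_code_positions n)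
  have add: "?enc (c + c') = ?enc c + ?enc c'" if "c \<in> carrier_vec k" "c' \<in> carrier_vec k" for c c'
  proof (rule eq_vecI)
    fix i
    assume "i < dim_vec (?enc c + ?enc c')"
    then have i: "i < n"
      by (simp add: codeword_vec_crt_map n)
    with pos[OF i] that show "?enc (c + c') $ i = (?enc c + ?enc c') $ i"
      by (auto simp: codeword_vec_crt_map poly_of_coeffs_add pcompose_add right_rem_add lin simp flip: n)
  qed (simp add: codeword_vec_crt_map)
  have smult: "?enc (a \<cdot>\<^sub>v c) = a \<cdot>\<^sub>v ?enc c" if "c \<in> carrier_vec k" for a c
  proof (rule eq_vecI)
    fix i
    assume "i < dim_vec (a \<cdot>\<^sub>v ?enc c)"
    then have i: "i < n"
      by (simp add: codeword_vec_crt_map n)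
    with pos[OF i] that show "?enc (a \<cdot>\<^sub>v c) $ i = (a \<cdot>\<^sub>v ?enc c) $ i"
      by (auto simp: codeword_vec_crt_map poly_of_coeffs_smult pcompose_smult right_rem_smult lin simp flip: n)
  qed (simp add: codeword_vec_crt_map)
  have carrier: "?enc c \<in> carrier_vec n" for c
    by (simp add: codeword_vec_crt_map n)
  have "?enc \<in> module_hom class_ring (module_vec TYPE('a) k) (module_vec TYPE('a) n)"
    unfolding module_hom_def using add smult carrier by (simp add: module_vec_simps)
  then show ?thesis
    by (intro linear_map.intro mod_hom.intro mod_hom_axioms.intro vec_vs vec_module)
qed

lemma rank_metric_code_qcrt_code:
  assumes F: "\<And>f. f \<in> set F \<Longrightarrow> linearized q f \<and> f \<noteq> (0 :: 'a poly)"
    and cop: "\<And>i. 1 \<le> i \<Longrightarrow> i < length F \<Longrightarrow> right_coprime q (F ! i) (llcm q (set (take i F)))"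
    and A: "linearized q A" "A \<noteq> 0" and n: "n = (\<Sum>f\<leftarrow>F. qdeg q f)" "k + qdeg q A < n"
  defines "C \<equiv> codeword_vec q F ` qcrt_code q F k A"
  shows "rank_metric_code q n C" and "code_dim n C = k"
proof -
  let ?V = "module_vec TYPE('a)"
  let ?enc = "\<lambda>c. codeword_vec q F (crt_map q F A (poly_of_coeffs k c))"
  interpret enc: linear_map class_ring "?V k" "?V n" ?enc
    by (rule linear_map_encode[OF F A(1) n(1)])
  \<comment> \<open>\<open>poly_of_coeffs k\<close> is onto \<open>linearized_less q k\<close>, so
    the code is the image of the encoding and thereby a subspace.\<close>
  have C: "enc.imT = C"
    unfolding C_def qcrt_code_def enc.im_def poly_of_coeffs_image[symmetric]
    by (simp add: image_image module_vec_simps)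
  have inj: "inj_on ?enc (carrier (?V k))"
  proof (rule enc.Ke0_imp_inj)
    have "poly_of_coeffs k c = 0" if "?enc c = 0\<^sub>v n" for c
      by (rule crt_map_injective[OF F cop A n poly_of_coeffs_less that])
    moreover have "?enc (0\<^sub>v k) = 0\<^sub>v n"
      using enc.f0_is_0 by (simp add: module_vec_simps)
    ultimately show "carrier (enc.V.vs enc.kerT) = {\<zero>\<^bsub>?V k\<^esub>}"
      unfolding enc.ker_def using poly_of_coeffs_eq_0 by (auto simp: module_vec_simps)
  qed
  show "rank_metric_code q n C"
    unfolding rank_metric_code_def
    using Metric_space_rank_dist enc.imT_is_subspace C by simp
  \<comment> \<open>Rank-nullity: the kernel has dimension \<open>0\<close>, so the image has the
    dimension \<open>k\<close> of the message space.\<close>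
  show "code_dim n C = k"
    unfolding code_dim_def
    using enc.rank_nullity_main(1)[OF vec_space.fin_dim] enc.inj_imp_dim_ker0[OF inj]
    by (simp add: C vec_space.dim_is_n)
qed

end

lemma linearized_polys_of_card:
  assumes q: "primepow q" and card: "CARD('a::{field,finite}) = q ^ m"
  shows "\<exists>e. linearized_polys TYPE('a) q e"
proof -
  obtain p e where p: "prime p" and e: "e > 0" and q: "q = p ^ e"
    using q by (auto simp: primepow_def)
  have CHAR: "prime CHAR('a)"
    using finite_imp_CHAR_pos[where 'a = 'a] by (intro prime_CHAR_semidom) simp
  \<comment> \<open>Translation by \<open>1\<close> permutes the field. Comparing the two sums shows
    that the order of the field is zero in it, so the prime characteristic divides a power of
    \<open>p\<close> and equals \<open>p\<close>.\<close>
  have "(\<Sum>x\<in>UNIV. x + 1) = (\<Sum>x\<in>UNIV. x :: 'a)"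
    by (rule sum.reindex_bij_witness[of _ "\<lambda>x. x - 1" "\<lambda>x. x + 1"]) auto
  then have "of_nat CARD('a) = (0 :: 'a)"
    by (simp add: sum.distrib)
  then have "CHAR('a) dvd p ^ (e * m)"
    unfolding of_nat_eq_0_iff_char_dvd card q by (simp add: power_mult)
  then have "CHAR('a) = p"
    using CHAR p prime_dvd_power primes_dvd_imp_eq by blast
  then have "linearized_polys TYPE('a) q e"
    using CHAR q e by unfold_locales simp_all
  then show ?thesis ..
qed

theorem proposition15:
  fixes F :: "'a::{field,finite} poly list" and A :: "'a poly"
    and q m s n k \<alpha> :: nat and d :: "nat \<Rightarrow> nat"
  assumes "primepow q" and "m \<ge> 1" and "CARD('a) = q ^ m"
    and "length F = s"
    and "\<And>i. i < s \<Longrightarrow> linearized q (F ! i) \<and> F ! i \<noteq> 0 \<and> qdeg q (F ! i) = d i"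
    and "\<And>i. 1 \<le> i \<Longrightarrow> i < s \<Longrightarrow> right_coprime q (F ! i) (llcm q (set (take i F)))"
    and "n = (\<Sum>i<s. d i)"
    and "linearized q A" and "A \<noteq> 0" and "qdeg q A = \<alpha>"
    and "k + \<alpha> < n"
  shows "rank_metric_code q n (codeword_vec q F ` qcrt_code q F k A) \<and>
    code_dim n (codeword_vec q F ` qcrt_code q F k A) = k"
proof -
  obtain e where "linearized_polys TYPE('a) q e"
    using linearized_polys_of_card assms by blast
  then interpret linearized_polys q e "TYPE('a)" .
  have F: "linearized q f \<and> f \<noteq> 0" if "f \<in> set F" for f
    using that assms(4,5) by (auto simp: in_set_conv_nth)
  have n: "n = (\<Sum>f\<leftarrow>F. qdeg q f)"
    using assms(4,5,7) by (simp add: sum_list_sum_nth atLeast0LessThan)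
  have cop: "right_coprime q (F ! i) (llcm q (set (take i F)))" if "1 \<le> i" "i < length F" for i
    using that assms(4,6) by simp
  have "k + qdeg q A < n"
    using assms by simp
  from rank_metric_code_qcrt_code[OF F cop assms(8,9) n this] show ?thesis
    by simp
qed

end
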